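(* Let $(X,d)$ be a cone metric space associated with a real Banach space $E$ and a cone $P\subseteq E$, and let $\{x_n\}$ be a bounded sequence in $X$. Then there exists $r\in E$ with $0\ll r$ or $r=0$ such that $\{x_n\}$ is $r$-Cauchy.
   Context: Cone: a subset $P$ of a real Banach space $E$ is a cone if (i) $P$ is closed, nonempty and $P\neq\{0\}$; (ii) $ax+by\in P$ for all real $a,b\ge 0$ and all $x,y\in P$; (iii) $x\in P$ and $-x\in P$ imply $x=0$. Orderings: for $x,y\in E$, $x\le y$ means $y-x\in P$, and $x\ll y$ means $y-x\in \operatorname{int}P$ (the interior of $P$). Cone metric space: a nonempty set $X$ with a map $d:X\times X\to E$ such that for all $x,y,z\in X$: $0\le d(x,y)$, with $d(x,y)=0$ if and only if $x=y$; $d(x,y)=d(y,x)$; $d(x,y)\le d(x,z)+d(z,y)$. A sequence $\{x_n\}$ in $X$ is bounded if there is $g\in\operatorname{int}P$ such that $d(x_m,x_n)\ll g$ for all $m,n\in\mathbb{N}$. For $r\in E$ with $0\ll r$ or $r=0$, a sequence $\{x_n\}$ in $X$ is $r$-Cauchy if for every $\epsilon\in E$ with $0\ll\epsilon$ there is $m\in\mathbb{N}$ such that $d(x_i,x_j)\ll r+\epsilon$ for all $i,j\ge m$. *)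

theory Defs
  imports "HOL-Analysis.Analysis"
begin

(* Stricter than the library's cone: closed, nontrivial, convex and pointed. *)
definition order_cone :: "'e::real_normed_vector set \<Rightarrow> bool" where
  "order_cone P \<longleftrightarrow>
     closed P \<and> P \<noteq> {} \<and> P \<noteq> {0} \<and>
     (\<forall>a b. \<forall>x\<in>P. \<forall>y\<in>P. 0 \<le> a \<longrightarrow> 0 \<le> b \<longrightarrow> a *\<^sub>R x + b *\<^sub>R y \<in> P) \<and>
     (\<forall>x. x \<in> P \<longrightarrow> - x \<in> P \<longrightarrow> x = 0)"

definition cone_le :: "'e::real_normed_vector set \<Rightarrow> 'e \<Rightarrow> 'e \<Rightarrow> bool" where
  "cone_le P x y \<longleftrightarrow> y - x \<in> P"

definition cone_ll :: "'e::real_normed_vector set \<Rightarrow> 'e \<Rightarrow> 'e \<Rightarrow> bool" where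
  "cone_ll P x y \<longleftrightarrow> y - x \<in> interior P"

(* The space is an explicit carrier X; the values of d outside X are irrelevant. *)
definition cone_metric_space ::
    "'e::real_normed_vector set \<Rightarrow> 'a set \<Rightarrow> ('a \<Rightarrow> 'a \<Rightarrow> 'e) \<Rightarrow> bool" where
  "cone_metric_space P X d \<longleftrightarrow>
     X \<noteq> {} \<and>
     (\<forall>x\<in>X. \<forall>y\<in>X. cone_le P 0 (d x y)) \<and>
     (\<forall>x\<in>X. \<forall>y\<in>X. d x y = 0 \<longleftrightarrow> x = y) \<and>
     (\<forall>x\<in>X. \<forall>y\<in>X. d x y = d y x) \<and>
     (\<forall>x\<in>X. \<forall>y\<in>X. \<forall>z\<in>X. cone_le P (d x y) (d x z + d z y))"

definition cone_bounded_seq ::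
    "'e::real_normed_vector set \<Rightarrow> ('a \<Rightarrow> 'a \<Rightarrow> 'e) \<Rightarrow> (nat \<Rightarrow> 'a) \<Rightarrow> bool" where
  "cone_bounded_seq P d x \<longleftrightarrow> (\<exists>g\<in>interior P. \<forall>m n. cone_ll P (d (x m) (x n)) g)"

(* Meant for r = 0 or cone_ll P 0 r; users state that restriction on r themselves. *)
definition r_Cauchy ::
    "'e::real_normed_vector set \<Rightarrow> ('a \<Rightarrow> 'a \<Rightarrow> 'e) \<Rightarrow> 'e \<Rightarrow> (nat \<Rightarrow> 'a) \<Rightarrow> bool" where
  "r_Cauchy P d r x \<longleftrightarrow>
     (\<forall>\<epsilon>. cone_ll P 0 \<epsilon> \<longrightarrow> (\<exists>m. \<forall>i\<ge>m. \<forall>j\<ge>m. cone_ll P (d (x i) (x j)) (r + \<epsilon>)))"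

end

theory Submission
  imports Defs
begin

text \<open>The bound \<open>g\<close> that witnesses boundedness can itself serve as
  \<open>r\<close>: it satisfies \<open>cone_ll P 0 g\<close>, and every distance stays below
  \<open>g\<close>, hence below \<open>g + e\<close> for each interior \<open>e\<close>. The passage
  from \<open>g\<close> to \<open>g + e\<close> rests on \<open>order_cone_add_interior\<close>, the
  absorption P + int P \<subseteq> int P.\<close>

lemma order_cone_add:
  assumes "order_cone P" "x \<in> P" "y \<in> P"
  shows "x + y \<in> P"
proof -
  have "1 *\<^sub>R x + 1 *\<^sub>R y \<in> P"
    using assms unfolding order_cone_def by (meson zero_le_one)
  then show ?thesis by simp
qed

text \<open>The translate of \<open>interior P\<close> by \<open>x\<close> is open and, since
  \<open>P\<close> is closed under addition, lies inside \<open>P\<close>; so all its points are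
  interior to \<open>P\<close>.\<close>

lemma order_cone_add_interior:
  assumes "order_cone P" "x \<in> P" "y \<in> interior P"
  shows "x + y \<in> interior P"
proof (rule interiorI)
  show "open ((+) x ` interior P)"
    by (simp add: open_translation)
  show "x + y \<in> (+) x ` interior P"
    using assms(3) by blast
  show "(+) x ` interior P \<subseteq> P"
    using assms(1,2) interior_subset by (blast intro: order_cone_add)
qed

theorem theorem3p2:
  fixes P :: "'e::banach set"
    and X :: "'a set"
    and d :: "'a \<Rightarrow> 'a \<Rightarrow> 'e"
    and x :: "nat \<Rightarrow> 'a"
  assumes "order_cone P"
    and "cone_metric_space P X d"
    and "range x \<subseteq> X"
    and "cone_bounded_seq P d x"
  shows "\<exists>r. (cone_ll P 0 r \<or> r = 0) \<and> r_Cauchy P d r x"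
proof -
  obtain g where g: "g \<in> interior P" and bound: "\<And>m n. g - d (x m) (x n) \<in> interior P"
    using assms(4) unfolding cone_bounded_seq_def cone_ll_def by blast
  have "g + e - d (x i) (x j) \<in> interior P" if "e \<in> interior P" for e i j
  proof -
    \<comment> \<open>The difference \<open>g - d (x i) (x j)\<close> enters as the summand in
      \<open>P\<close>, and \<open>e\<close> as the interior one.\<close>
    have "(g - d (x i) (x j)) + e \<in> interior P"
      using assms(1) bound interior_subset that by (blast intro: order_cone_add_interior)
    then show ?thesis by (simp add: algebra_simps)
  qed
  \<comment> \<open>The estimate holds for all indices \<open>i\<close> and \<open>j\<close>, so any
    threshold \<open>m\<close> will do.\<close>
  then have "r_Cauchy P d g x"
    unfolding r_Cauchy_def cone_ll_def by simp
  with g show ?thesis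
    unfolding cone_ll_def by auto
qed

end
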